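(* Let $\alpha>-1$ be real with $\alpha\ne0,1,2,\ldots$. Then for all $n=0,1,\ldots$ and $0<\xi<\infty$, $$\pi\cot(\pi\alpha)\,\xi^\alpha e^{-\xi}L_n^\alpha(\xi)+\int_0^\infty\frac{\eta^\alpha e^{-\eta}L_n^\alpha(\eta)\,d\eta}{\eta-\xi}=\Gamma(\alpha)\,e^{-\xi}\,\Phi(-n-\alpha,1-\alpha;\xi).$$
   Context: The integral is a Cauchy principal value. $L_n^\alpha(x)=\sum_{k=0}^n\binom{n+\alpha}{n-k}\frac{(-1)^kx^k}{k!}$ are the (generalized) Laguerre polynomials, with $\binom{a}{n}=\frac{\Gamma(a+1)}{n!\,\Gamma(a-n+1)}$. $\Phi(a,c;x)=\sum_{k=0}^\infty \frac{(a)_k x^k}{(c)_k k!}$ is the confluent hypergeometric function, $(a)_k=a(a+1)\cdots(a+k-1)$. *)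

theory Defs
  imports "HOL-Analysis.Analysis" "HOL-Real_Asymp.Real_Asymp"
begin

text \<open>
  The generalized binomial coefficient is the library's \<^const>\<open>gbinomial\<close>. It agrees with the
  quotient of Gamma functions by \<open>gbinomial_Gamma\<close> whenever the upper argument is not a negative
  integer; for \<open>\<alpha> > -1\<close> it is \<open>n + \<alpha> > -1\<close>.
\<close>

definition laguerre :: "nat \<Rightarrow> real \<Rightarrow> real \<Rightarrow> real" where
  "laguerre n \<alpha> x =
     (\<Sum>k\<le>n. ((real n + \<alpha>) gchoose (n - k)) * ((-1) ^ k * x ^ k / fact k))"

lemma laguerre_Gamma:
  assumes "\<alpha> > -1"
  shows "laguerre n \<alpha> x =
    (\<Sum>k\<le>n. Gamma (real n + \<alpha> + 1) /
        (fact (n - k) * Gamma (real n + \<alpha> - real (n - k) + 1)) * ((-1) ^ k * x ^ k / fact k))"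
proof -
  have "real n + \<alpha> + 1 \<notin> \<int>\<^sub>\<le>\<^sub>0"
    using assms by (auto elim!: nonpos_Ints_cases)
  then show ?thesis
    unfolding laguerre_def by (simp add: gbinomial_Gamma)
qed

definition confluent_hypergeometric :: "real \<Rightarrow> real \<Rightarrow> real \<Rightarrow> real" where
  "confluent_hypergeometric a c x =
     (\<Sum>k. pochhammer a k * x ^ k / (pochhammer c k * fact k))"

lemma summable_confluent_hypergeometric:
  fixes a c x :: real
  assumes "c \<notin> \<int>\<^sub>\<le>\<^sub>0"
  shows "summable (\<lambda>k. pochhammer a k * x ^ k / (pochhammer c k * fact k))"
proof -
  let ?f = "\<lambda>k. pochhammer a k * x ^ k / (pochhammer c k * fact k)"
  let ?r = "\<lambda>k::nat. (a + real k) * x / ((c + real k) * (real k + 1))"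
  have "?r \<longlonglongrightarrow> 0" by real_asymp
  then have "eventually (\<lambda>k. \<bar>?r k\<bar> < 1/2) sequentially"
    using order_tendstoD(2)[OF tendsto_rabs_zero, of ?r sequentially "1/2"] by simp
  then obtain N where N: "\<And>k. k \<ge> N \<Longrightarrow> \<bar>?r k\<bar> < 1/2"
    by (auto simp: eventually_sequentially)
  have step: "?f (Suc k) = ?r k * ?f k" for k
    by (simp add: pochhammer_rec' add.commute mult_ac)
  have "norm (?f (Suc k)) \<le> 1/2 * norm (?f k)" if "k \<ge> N" for k
    unfolding step real_norm_def abs_mult[of "?r k"]
    by (rule mult_right_mono[OF less_imp_le[OF N[OF that]]]) simp
  then show ?thesis
    by (intro summable_ratio_test[of "1/2" N]) auto
qed

text \<open>
  Cauchy principal value over \<open>S\<close> with respect to a single singularity \<open>x\<close> in the interior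
  of \<open>S\<close>: a symmetric neighbourhood of \<open>x\<close> is removed. Outside of it the Lebesgue integral is
  required to converge absolutely, so no further limit at the ends of \<open>S\<close> is involved.
\<close>

definition has_pv_integral :: "(real \<Rightarrow> real) \<Rightarrow> real \<Rightarrow> real set \<Rightarrow> real \<Rightarrow> bool" where
  "has_pv_integral f I S x \<longleftrightarrow>
     (\<forall>\<epsilon>>0. set_integrable lborel (S - ball x \<epsilon>) f) \<and>
     ((\<lambda>\<epsilon>. set_lebesgue_integral lborel (S - ball x \<epsilon>) f) \<longlongrightarrow> I) (at_right 0)"

definition pv_integrable :: "(real \<Rightarrow> real) \<Rightarrow> real set \<Rightarrow> real \<Rightarrow> bool" where
  "pv_integrable f S x \<longleftrightarrow> (\<exists>I. has_pv_integral f I S x)"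

definition pv_integral :: "(real \<Rightarrow> real) \<Rightarrow> real set \<Rightarrow> real \<Rightarrow> real" where
  "pv_integral f S x = (THE I. has_pv_integral f I S x)"

lemma pv_integral_unique: "has_pv_integral f I S x \<Longrightarrow> pv_integral f S x = I"
  unfolding pv_integral_def has_pv_integral_def
  by (rule the_equality) (auto intro: tendsto_unique[of "at_right (0::real)"])

end

theory Submission
  imports Defs
begin

text \<open>
  By linearity it suffices to treat the weights \<open>y\<^sup>b e\<^sup>-\<^sup>y\<close> with \<open>b = \<alpha> + k\<close>, and the identity
  \<open>y / (y - x) = 1 + x / (y - x)\<close> moves \<open>b\<close> to \<open>b + 1\<close>, so \<open>-1 < b < 0\<close> suffices. There
  \<open>e\<^sup>x\<^sup>-\<^sup>y = 1 - (1 - e\<^sup>x\<^sup>-\<^sup>y)\<close> splits the integral into an absolutely convergent one, which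
  Tonelli turns into the series \<open>-\<Gamma>(b+1) \<Sum>\<^sub>k x\<^sup>k / (k! (k - b))\<close>, and the principal value of
  \<open>y\<^sup>b / (y - x)\<close>. Comparing the latter with a kernel of principal value zero gives geometric series
  summing to \<open>x\<^sup>b (\<psi>(1 + b) - \<psi>(-b)) = -\<pi> cot(\<pi>b) x\<^sup>b\<close>. The Laguerre combination of the
  series is the confluent hypergeometric function by a partial fraction expansion of
  \<open>n! / (z (z + 1) \<cdots> (z + n))\<close>.
\<close>

subsection \<open>Series and special values\<close>

lemma not_Nats_imp_not_Ints:
  fixes x :: real
  assumes "x > -1" "x \<notin> \<nat>"
  shows "x \<notin> \<int>"
proof
  assume "x \<in> \<int>"
  then obtain k :: int where k: "x = of_int k" by (auto elim: Ints_cases)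
  with assms(1) have "k \<ge> 0" by simp
  with k have "x = of_nat (nat k)" by simp
  with assms(2) show False by (metis of_nat_in_Nats)
qed

text \<open>Partial fractions: the right side has simple poles at x = -k with residue (-1)^k (n
  choose k). The induction keeps \<open>x\<close> arbitrary because Pascal's rule writes the sum for
  \<open>Suc n\<close> at \<open>x\<close> as the sum for \<open>n\<close> at \<open>x\<close> minus
  the sum for \<open>n\<close> at \<open>x + 1\<close>.\<close>

lemma sum_binomial_alternating_reciprocal:
  fixes x :: "'a::field_char_0"
  assumes "\<And>k. k \<le> n \<Longrightarrow> x + of_nat k \<noteq> 0"
  shows "(\<Sum>k\<le>n. (-1) ^ k * of_nat (n choose k) / (x + of_nat k)) = fact n / pochhammer x (Suc n)"
  using assms
proof (induction n arbitrary: x)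
  case (Suc n)
  have nz: "x + of_nat k \<noteq> 0" if "k \<le> Suc n" for k using Suc.prems that by blast
  have nz': "x + 1 + of_nat k \<noteq> 0" if "k \<le> n" for k
    using nz[of "Suc k"] that by (simp add: algebra_simps)
  have p: "pochhammer (x + 1) n \<noteq> 0"
    using nz' by (auto simp: pochhammer_eq_0_iff) (metis add.commute add.right_inverse less_imp_le)
  let ?t = "\<lambda>n k. (-1) ^ k * of_nat (n choose k) / (x + of_nat k) :: 'a"
  have "(\<Sum>k\<le>Suc n. ?t (Suc n) k) = ?t (Suc n) 0 + (\<Sum>k\<le>n. ?t (Suc n) (Suc k))"
    by (rule sum.atMost_Suc_shift)
  also have "(\<Sum>k\<le>n. ?t (Suc n) (Suc k)) = (\<Sum>k\<le>n. ?t n (Suc k))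
      - (\<Sum>k\<le>n. (-1) ^ k * of_nat (n choose k) / (x + 1 + of_nat k))"
    unfolding sum_subtractf[symmetric]
    by (intro sum.cong refl) (simp add: add_ac diff_divide_distrib add_divide_distrib algebra_simps)
  also have "?t (Suc n) 0 + ((\<Sum>k\<le>n. ?t n (Suc k)) - (\<Sum>k\<le>n. (-1) ^ k * of_nat (n choose k) / (x + 1 + of_nat k)))
     = (\<Sum>k\<le>Suc n. ?t n k) - (\<Sum>k\<le>n. (-1) ^ k * of_nat (n choose k) / (x + 1 + of_nat k))"
    by (subst sum.atMost_Suc_shift) simp
  \<comment> \<open>The last term \<open>k = Suc n\<close> is zero because
    \<open>n choose Suc n\<close> is.\<close>
  also have "(\<Sum>k\<le>Suc n. ?t n k) = fact n / pochhammer x (Suc n)"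
    using Suc.IH[of x] nz by simp
  also have "(\<Sum>k\<le>n. (-1) ^ k * of_nat (n choose k) / (x + 1 + of_nat k)) = fact n / pochhammer (x + 1) (Suc n)"
    using Suc.IH[of "x + 1"] nz' by simp
  also have "pochhammer x (Suc n) = x * pochhammer (x + 1) n"
    by (rule pochhammer_rec)
  also have "pochhammer (x + 1) (Suc n) = pochhammer (x + 1) n * (x + 1 + of_nat n)"
    by (rule pochhammer_Suc)
  also have "fact n / (x * pochhammer (x + 1) n) - fact n / (pochhammer (x + 1) n * (x + 1 + of_nat n))
    = fact (Suc n) / (x * (pochhammer (x + 1) n * (x + 1 + of_nat n)))"
    using p nz[of 0] nz'[of n] by (simp add: divide_simps) (simp add: algebra_simps)
  also have "x * (pochhammer (x + 1) n * (x + 1 + of_nat n)) = pochhammer x (Suc (Suc n))"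
    by (simp only: pochhammer_rec[of x "Suc n"] pochhammer_Suc[of "x + 1"])
  finally show ?case .
qed simp

text \<open>Up to the common sign (-1)^m, both sides are the product of the n + m + 1 consecutive
  factors a - m, ..., a + n. The left side splits it after a - 1, the right side after a - m +
  n.\<close>

lemma pochhammer_reflect:
  fixes a :: "'a::comm_ring_1"
  shows "pochhammer a (Suc n) * pochhammer (1 - a) m = pochhammer (a - of_nat m) (Suc n) * pochhammer (- of_nat n - a) m"
proof -
  have "pochhammer (1 - a) m = (-1) ^ m * pochhammer (a - of_nat m) m"
    using pochhammer_minus[of "a - 1" m] by (simp add: algebra_simps)
  moreover have "pochhammer (- of_nat n - a) m = (-1) ^ m * pochhammer (a - of_nat m + of_nat (Suc n)) m"
  proof -
    have "- of_nat n - a = - (a + of_nat n)" by simp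
    moreover have "a + of_nat n - of_nat m + 1 = a - of_nat m + of_nat (Suc n)" by simp
    ultimately show ?thesis
      using pochhammer_minus[of "a + of_nat n" m] by (simp only:)
  qed
  moreover have "pochhammer a (Suc n) * pochhammer (a - of_nat m) m = pochhammer (a - of_nat m) (Suc n) * pochhammer (a - of_nat m + of_nat (Suc n)) m"
    using pochhammer_product'[of "a - of_nat m" m "Suc n"] pochhammer_product'[of "a - of_nat m" "Suc n" m]
    by (simp add: add.commute mult.commute del: of_nat_Suc)
  ultimately show ?thesis by (simp only: mult.left_commute[of _ "(-1) ^ m"])
qed

text \<open>This is the coefficient of x^m / m! in the series of
  \<open>laguerre_shifted_exp\<close>. Multiplying the binomial coefficient by the Gamma value
  leaves only (n choose k) depending on k, so the sum is a partial fraction expansion at the point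
  \<alpha> - m.\<close>

lemma sum_laguerre_coeff:
  fixes \<alpha> :: real
  assumes "\<alpha> > -1" "\<alpha> \<notin> \<int>"
  shows "(\<Sum>k\<le>n. ((real n + \<alpha>) gchoose (n - k)) * ((-1) ^ k / fact k) * (Gamma (\<alpha> + real k + 1) / (\<alpha> + real k - real m)))
    = Gamma \<alpha> * pochhammer (- real n - \<alpha>) m / pochhammer (1 - \<alpha>) m"
proof -
  have nz: "\<alpha> - real m + real k \<noteq> 0" for k
  proof
    assume "\<alpha> - real m + real k = 0"
    then have "\<alpha> = of_int (int m - int k)" by simp
    with assms(2) show False by (metis Ints_of_int)
  qed
  have nonpos: "\<alpha> \<notin> \<int>\<^sub>\<le>\<^sub>0" "\<alpha> + real k + 1 \<notin> \<int>\<^sub>\<le>\<^sub>0" for k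
    using assms nonpos_Ints_subset_Ints by (auto elim!: nonpos_Ints_cases)
  have p: "pochhammer (\<alpha> - real m) (Suc n) \<noteq> 0"
    unfolding pochhammer_eq_0_iff using nz by (metis add.commute add.right_inverse)
  have p': "pochhammer (1 - \<alpha>) m \<noteq> 0"
    unfolding pochhammer_eq_0_iff
  proof safe
    fix k assume "1 - \<alpha> = - real k"
    then have "\<alpha> = of_int (int k + 1)" by simp
    with assms(2) show False by (metis Ints_of_int)
  qed
  have "(\<Sum>k\<le>n. ((real n + \<alpha>) gchoose (n - k)) * ((-1) ^ k / fact k) * (Gamma (\<alpha> + real k + 1) / (\<alpha> + real k - real m)))
     = (\<Sum>k\<le>n. Gamma (\<alpha> + real n + 1) / fact n * ((-1) ^ k * real (n choose k) / (\<alpha> - real m + real k)))"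
  proof (intro sum.cong refl)
    fix k assume "k \<in> {..n}"
    then have k: "k \<le> n" by simp
    have "pochhammer (\<alpha> + real k + 1) (n - k) * Gamma (\<alpha> + real k + 1) = Gamma (\<alpha> + real n + 1)"
      using pochhammer_Gamma[OF nonpos(2)[of k], of "n - k"] Gamma_eq_zero_iff[of "\<alpha> + real k + 1"] nonpos(2)[of k] k
      by (simp add: of_nat_diff add_ac)
    moreover have "((real n + \<alpha>) gchoose (n - k)) = pochhammer (\<alpha> + real k + 1) (n - k) / fact (n - k)"
      unfolding gbinomial_pochhammer' using k by (simp add: of_nat_diff algebra_simps)
    moreover have "real (n choose k) = fact n / (fact k * fact (n - k))"
      by (rule binomial_fact[OF k])
    moreover have "\<alpha> + real k - real m = \<alpha> - real m + real k" by simp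
    \<comment> \<open>\<open>P\<close> is the Pochhammer symbol and \<open>G\<close> the Gamma
      value; their product no longer depends on \<open>k\<close>.\<close>
    moreover have "P / F * (s / a) * (G / D) = P * G / f * (s * (f / (a * F)) / D)"
      if "f \<noteq> 0" for P F s a G D f :: real
      using that by (simp add: mult_ac)
    ultimately show "((real n + \<alpha>) gchoose (n - k)) * ((-1) ^ k / fact k) * (Gamma (\<alpha> + real k + 1) / (\<alpha> + real k - real m))
       = Gamma (\<alpha> + real n + 1) / fact n * ((-1) ^ k * real (n choose k) / (\<alpha> - real m + real k))"
      by (metis fact_nonzero)
  qed
  also have "\<dots> = Gamma (\<alpha> + real n + 1) / pochhammer (\<alpha> - real m) (Suc n)"
    unfolding sum_distrib_left[symmetric]
    by (subst sum_binomial_alternating_reciprocal) (use nz in simp_all)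
  also have "Gamma (\<alpha> + real n + 1) = Gamma \<alpha> * pochhammer \<alpha> (Suc n)"
    using pochhammer_Gamma[OF nonpos(1), of "Suc n"] Gamma_eq_zero_iff[of \<alpha>] nonpos(1)
    by (simp add: add_ac)
  also have "Gamma \<alpha> * pochhammer \<alpha> (Suc n) / pochhammer (\<alpha> - real m) (Suc n)
    = Gamma \<alpha> * pochhammer (- real n - \<alpha>) m / pochhammer (1 - \<alpha>) m"
    using pochhammer_reflect[of \<alpha> n m] p p' by (simp add: field_simps)
  finally show ?thesis .
qed

text \<open>When b is not a natural number this equals -\<Phi>(-b, 1-b; x) / b; for b < 0 it is also
  the integral of u^(-b-1) e^(ux) over 0 < u < 1, which is how it enters below.\<close>

definition shifted_exp :: "real \<Rightarrow> real \<Rightarrow> real" where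
  "shifted_exp b x = (\<Sum>k. x ^ k / (fact k * (real k - b)))"

text \<open>As soon as k - b >= 1, the exponential series dominates. A term with k = b is zero,
  being a division by zero.\<close>

lemma shifted_exp_sums:
  fixes b x :: real
  shows "(\<lambda>k. x ^ k / (fact k * (real k - b))) sums shifted_exp b x"
proof -
  have "summable (\<lambda>k. x ^ k / (fact k * (real k - b)))"
  proof (rule summable_comparison_test_ev)
    show "summable (\<lambda>k. \<bar>x\<bar> ^ k / fact k)"
      using summable_exp[of "\<bar>x\<bar>"] by (simp add: field_simps)
    show "\<forall>\<^sub>F k in sequentially. norm (x ^ k / (fact k * (real k - b))) \<le> \<bar>x\<bar> ^ k / fact k"
      using eventually_ge_at_top[of "nat \<lceil>b + 1\<rceil>"]
    proof eventually_elim
      case (elim k)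
      then have "real k - b \<ge> 1" by linarith
      then have "norm (x ^ k / (fact k * (real k - b))) = \<bar>x\<bar> ^ k / (fact k * (real k - b))"
        by (simp add: abs_mult power_abs)
      also have "\<dots> \<le> \<bar>x\<bar> ^ k / (fact k * 1)"
        using \<open>real k - b \<ge> 1\<close> by (intro divide_left_mono mult_left_mono) auto
      finally show ?case by simp
    qed
  qed
  then show ?thesis unfolding shifted_exp_def by (rule summable_sums)
qed

text \<open>An index shift turns x times the series for b into the sum of k x^k / (k! (k - 1 - b)),
  and k / (k - 1 - b) - 1 = (b + 1) / (k - 1 - b). It matches the passage from b to b + 1 in the
  integrals.\<close>

lemma shifted_exp_add_1:
  assumes "b \<notin> \<int>"
  shows "(b + 1) * shifted_exp (b + 1) x = x * shifted_exp b x - exp x"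
proof -
  have nz: "real k - 1 - b \<noteq> 0" for k
  proof
    assume "real k - 1 - b = 0"
    then have "b = of_int (int k - 1)" by simp
    with assms show False by (metis Ints_of_int)
  qed
  have "(\<lambda>k. x * (x ^ k / (fact k * (real k - b)))) sums (x * shifted_exp b x)"
    by (intro sums_mult shifted_exp_sums)
  moreover have "x * (x ^ k / (fact k * (real k - b)))
    = real (Suc k) * x ^ (Suc k) / (fact (Suc k) * (real (Suc k) - 1 - b))" for k
  proof -
    have "real (Suc k) * x ^ (Suc k) / (fact (Suc k) * (real (Suc k) - 1 - b))
        = (real (Suc k) * (x * x ^ k)) / (real (Suc k) * (fact k * (real k - b)))"
      by (simp add: mult.assoc)
    also have "\<dots> = (x * x ^ k) / (fact k * (real k - b))"
      by (rule mult_divide_mult_cancel_left) simp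
    finally show ?thesis by simp
  qed
  ultimately have "(\<lambda>k. real (Suc k) * x ^ (Suc k) / (fact (Suc k) * (real (Suc k) - 1 - b))) sums (x * shifted_exp b x)"
    by simp
  \<comment> \<open>The factor \<open>real k\<close> kills the term at 0, so the shifted series may
    start there.\<close>
  then have "(\<lambda>k. real k * x ^ k / (fact k * (real k - 1 - b))) sums (x * shifted_exp b x)"
    by (subst (asm) sums_Suc_iff) simp
  from sums_diff[OF this exp_converges[of x]]
  have "(\<lambda>k. real k * x ^ k / (fact k * (real k - 1 - b)) - x ^ k /\<^sub>R fact k) sums (x * shifted_exp b x - exp x)" .
  moreover have "real k * x ^ k / (fact k * (real k - 1 - b)) - x ^ k /\<^sub>R fact k
    = (b + 1) * (x ^ k / (fact k * (real k - (b + 1))))" for k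
    using nz[of k] by (simp add: divide_simps) (simp add: algebra_simps)
  ultimately have "(\<lambda>k. (b + 1) * (x ^ k / (fact k * (real k - (b + 1))))) sums (x * shifted_exp b x - exp x)"
    by simp
  with sums_mult[OF shifted_exp_sums[of x "b + 1"], of "b + 1"] show ?thesis
    by (rule sums_unique2)
qed

text \<open>The finite sum is taken inside the power series, whose coefficients
  \<open>sum_laguerre_coeff\<close> then evaluates as those of \<Phi>.\<close>

lemma laguerre_shifted_exp:
  fixes \<alpha> x :: real
  assumes "\<alpha> > -1" "\<alpha> \<notin> \<int>"
  shows "(\<Sum>k\<le>n. ((real n + \<alpha>) gchoose (n - k)) * ((-1) ^ k / fact k) * (- Gamma (\<alpha> + real k + 1) * shifted_exp (\<alpha> + real k) x))
    = Gamma \<alpha> * confluent_hypergeometric (- real n - \<alpha>) (1 - \<alpha>) x"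
proof -
  let ?c = "\<lambda>k. ((real n + \<alpha>) gchoose (n - k)) * ((-1) ^ k / fact k)"
  have "1 - \<alpha> \<notin> \<int>\<^sub>\<le>\<^sub>0"
    using assms(2) nonpos_Ints_subset_Ints Ints_1 Ints_diff[of 1 "1 - \<alpha>"] by auto
  from summable_sums[OF summable_confluent_hypergeometric[OF this, of "- real n - \<alpha>" x]]
  have "(\<lambda>m. Gamma \<alpha> * (pochhammer (- real n - \<alpha>) m * x ^ m / (pochhammer (1 - \<alpha>) m * fact m)))
      sums (Gamma \<alpha> * confluent_hypergeometric (- real n - \<alpha>) (1 - \<alpha>) x)"
    unfolding confluent_hypergeometric_def by (rule sums_mult)
  moreover have "(\<lambda>m. \<Sum>k\<le>n. ?c k * (- Gamma (\<alpha> + real k + 1) * (x ^ m / (fact m * (real m - (\<alpha> + real k))))))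
     sums (\<Sum>k\<le>n. ?c k * (- Gamma (\<alpha> + real k + 1) * shifted_exp (\<alpha> + real k) x))"
    by (intro sums_sum sums_mult shifted_exp_sums)
  moreover have "(\<Sum>k\<le>n. ?c k * (- Gamma (\<alpha> + real k + 1) * (x ^ m / (fact m * (real m - (\<alpha> + real k))))))
    = Gamma \<alpha> * (pochhammer (- real n - \<alpha>) m * x ^ m / (pochhammer (1 - \<alpha>) m * fact m))" for m
  proof -
    have "(\<Sum>k\<le>n. ?c k * (- Gamma (\<alpha> + real k + 1) * (x ^ m / (fact m * (real m - (\<alpha> + real k))))))
       = (\<Sum>k\<le>n. ?c k * (Gamma (\<alpha> + real k + 1) / (\<alpha> + real k - real m))) * (x ^ m / fact m)"
      unfolding sum_distrib_right
    proof (intro sum.cong refl)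
      fix k
      have "\<alpha> + real k - real m = - (real m - (\<alpha> + real k))"
        by simp
      then show "?c k * (- Gamma (\<alpha> + real k + 1) * (x ^ m / (fact m * (real m - (\<alpha> + real k)))))
        = ?c k * (Gamma (\<alpha> + real k + 1) / (\<alpha> + real k - real m)) * (x ^ m / fact m)"
        by (simp only: minus_divide_right[symmetric]) (simp add: mult_ac)
    qed
    then show ?thesis unfolding sum_laguerre_coeff[OF assms] by simp
  qed
  ultimately show ?thesis by (simp add: sums_unique2)
qed

text \<open>Differentiate both sides of the reflection formula 1 / (Gamma(y) Gamma(1 - y)) = sin(pi
  y) / pi and divide by the undifferentiated identity.\<close>

lemma Digamma_reflection_real:
  fixes x :: real
  assumes "x \<notin> \<int>"
  shows "Digamma (1 - x) - Digamma x = pi * cot (pi * x)"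
proof -
  have x: "x \<notin> \<int>\<^sub>\<le>\<^sub>0" "1 - x \<notin> \<int>\<^sub>\<le>\<^sub>0"
    using assms nonpos_Ints_subset_Ints Ints_1 Ints_diff[of 1 "1 - x"] by auto
  \<comment> \<open>The complex reflection formula is pulled back along the embedding of the
    reals.\<close>
  have refl: "rGamma y * rGamma (1 - y) = sin (pi * y) / pi" for y :: real
  proof -
    have "complex_of_real (rGamma y * rGamma (1 - y)) = complex_of_real (sin (pi * y) / pi)"
    proof -
      have "rGamma (complex_of_real y) * rGamma (complex_of_real (1 - y)) = sin (complex_of_real (pi * y)) / complex_of_real pi"
        using rGamma_reflection_complex[of "of_real y"] by simp
      then show ?thesis
        by (simp only: rGamma_complex_of_real sin_of_real flip: of_real_mult of_real_divide)
    qed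
    then show ?thesis by (simp only: of_real_eq_iff)
  qed
  have "((\<lambda>y. rGamma y * rGamma (1 - y)) has_real_derivative
      rGamma x * rGamma (1 - x) * (Digamma (1 - x) - Digamma x)) (at x)"
    using x by (auto intro!: derivative_eq_intros simp: algebra_simps)
  moreover have "((\<lambda>y. rGamma y * rGamma (1 - y)) has_real_derivative cos (pi * x)) (at x)"
    unfolding refl by (auto intro!: derivative_eq_intros)
  ultimately have "sin (pi * x) / pi * (Digamma (1 - x) - Digamma x) = cos (pi * x)"
    unfolding refl by (rule DERIV_unique)
  moreover have "sin (pi * x) \<noteq> 0"
    using refl[of x] x by (auto simp: rGamma_eq_zero_iff)
  ultimately show ?thesis by (simp add: cot_def field_simps)
qed

text \<open>The defining series with its sign reversed. It is applied at b + 1 and at -b, and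
  Euler's constant cancels in the difference.\<close>

lemma Digamma_sums:
  fixes x :: real
  assumes "x > 0"
  shows "(\<lambda>k. 1 / (real k + x) - 1 / (real k + 1)) sums (- Digamma x - euler_mascheroni)"
proof -
  have "(\<lambda>k. inverse (of_nat (Suc k)) - inverse (x + of_nat k)) sums (Digamma x + euler_mascheroni)"
    using summable_sums[OF summable_Digamma[of x]] assms by (simp add: Digamma_def)
  from sums_minus[OF this] show ?thesis by (simp add: inverse_eq_divide add_ac minus_diff_commute)
qed

subsection \<open>Absolutely convergent integrals\<close>

text \<open>Termwise integration by monotone convergence; the finite sum \<open>C\<close> gives
  integrability. Convergence is asked only almost everywhere, so that singular points may be
  dropped.\<close>

lemma has_bochner_integral_sums_nonneg:
  fixes f :: "nat \<Rightarrow> 'a \<Rightarrow> real"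
  assumes f: "\<And>k. has_bochner_integral M (f k) (c k)"
    and nonneg: "\<And>k x. x \<in> space M \<Longrightarrow> 0 \<le> f k x"
    and lim: "AE x in M. (\<lambda>k. f k x) sums g x"
    and [measurable]: "g \<in> borel_measurable M"
    and C: "c sums C"
  shows "has_bochner_integral M g C"
proof (rule has_bochner_integral_nn_integral)
  have [measurable]: "f k \<in> borel_measurable M" for k
    using f by (rule borel_measurable_has_bochner_integral)
  have c: "0 \<le> c k" for k
    using f[of k] nonneg by (metis Bochner_Integration.integral_nonneg has_bochner_integral_integral_eq)
  then show "0 \<le> C"
    using C sums_le[OF _ sums_zero C] by simp
  from lim show "AE x in M. 0 \<le> g x"
    using AE_space
  proof eventually_elim
    case (elim x)
    show ?case by (rule sums_le[OF _ sums_zero elim(1)]) (use nonneg elim(2) in auto)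
  qed
  have "(\<integral>\<^sup>+x. g x \<partial>M) = (\<integral>\<^sup>+x. (\<Sum>k. ennreal (f k x)) \<partial>M)"
  proof (rule nn_integral_cong_AE)
    show "AE x in M. ennreal (g x) = (\<Sum>k. ennreal (f k x))"
      using lim AE_space
    proof eventually_elim
      case (elim x)
      show ?case
        unfolding sums_unique[OF elim(1)]
        by (rule suminf_ennreal2[symmetric, OF nonneg[OF elim(2)] sums_summable[OF elim(1)]])
    qed
  qed
  also have "\<dots> = (\<Sum>k. \<integral>\<^sup>+x. f k x \<partial>M)"
    by (rule nn_integral_suminf) simp
  also have "\<dots> = (\<Sum>k. ennreal (c k))"
  proof (intro suminf_cong)
    show "(\<integral>\<^sup>+x. f k x \<partial>M) = ennreal (c k)" for k
      using f[of k] nonneg nn_integral_eq_integral[of M "f k"] by (auto simp: has_bochner_integral_iff)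
  qed
  also have "\<dots> = ennreal C"
    unfolding sums_unique[OF C] by (rule suminf_ennreal2[OF c sums_summable[OF C]])
  finally show "(\<integral>\<^sup>+x. g x \<partial>M) = ennreal C" .
qed simp

text \<open>Nonnegativity makes a gauge integral a Lebesgue integral, so known gauge integrals of
  powers and of the Gamma integrand can be used.\<close>

lemma has_bochner_integral_has_integral_nonneg:
  fixes f :: "real \<Rightarrow> real"
  assumes "(f has_integral I) S" "\<And>x. x \<in> S \<Longrightarrow> 0 \<le> f x"
    and [measurable]: "f \<in> borel_measurable borel" "S \<in> sets borel"
  shows "has_bochner_integral lborel (\<lambda>x. indicator S x * f x) I"
proof (rule has_bochner_integral_nn_integral)
  show "0 \<le> I" using assms(1,2) by (rule has_integral_nonneg)
  show "(\<integral>\<^sup>+x. ennreal (indicator S x * f x) \<partial>lborel) = ennreal I"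
    by (rule nn_integral_has_integral_lebesgue) (use assms in auto)
qed (use assms(2) in \<open>auto simp: indicator_def\<close>)

section \<open>Power, Gamma and quotient integrals\<close>

lemma has_bochner_integral_powr_from_0:
  fixes a c :: real
  assumes "a > -1" "c \<ge> 0"
  shows "has_bochner_integral lborel (\<lambda>x. indicator {0..c} x * x powr a) (c powr (a + 1) / (a + 1))"
  by (rule has_bochner_integral_has_integral_nonneg[OF has_integral_powr_from_0[OF assms]]) auto

lemma has_bochner_integral_powr_to_inf:
  fixes a c :: real
  assumes "a < -1" "c > 0"
  shows "has_bochner_integral lborel (\<lambda>x. indicator {c..} x * x powr a) (- (c powr (a + 1)) / (a + 1))"
  by (rule has_bochner_integral_has_integral_nonneg[OF has_integral_powr_to_inf[OF assms]]) auto

lemma has_bochner_integral_Gamma_scaled: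
  fixes s u :: real
  assumes "s > 0" "u > 0"
  shows "has_bochner_integral lborel (\<lambda>x. indicator {0..} x * (x powr (s - 1) * exp (- u * x))) (Gamma s * u powr (- s))"
proof -
  have "has_bochner_integral lborel (\<lambda>x. indicator {0..} x * (x powr (s - 1) / exp x)) (Gamma s)"
    by (rule has_bochner_integral_has_integral_nonneg[OF Gamma_integral_real[OF assms(1)]]) auto
  then have "has_bochner_integral lborel (\<lambda>x. indicator {0..} (0 + u * x) * ((0 + u * x) powr (s - 1) / exp (0 + u * x))) (Gamma s /\<^sub>R \<bar>u\<bar>)"
    by (rule lborel_has_bochner_integral_real_affine_iff[THEN iffD1, rotated]) (use assms in simp)
  \<comment> \<open>This factor undoes the \<open>u powr (s - 1)\<close> produced by substituting
    \<open>u * x\<close> into Euler's integral.\<close>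
  from has_bochner_integral_mult_right[OF this, of "u powr (1 - s)"]
  have "has_bochner_integral lborel (\<lambda>x. u powr (1 - s) * (indicator {0..} (0 + u * x) * ((0 + u * x) powr (s - 1) / exp (0 + u * x)))) (u powr (1 - s) * (Gamma s /\<^sub>R \<bar>u\<bar>))"
    by simp
  moreover have "u powr (1 - s) * (indicator {0..} (0 + u * x) * ((0 + u * x) powr (s - 1) / exp (0 + u * x)))
      = indicator {0..} x * (x powr (s - 1) * exp (- u * x))" for x
  proof -
    have "u powr (1 - s) * (u powr (s - 1) * z) = z" for z
      using assms by (simp flip: mult.assoc powr_add)
    then show ?thesis
      using assms by (auto simp: indicator_def zero_le_mult_iff powr_mult exp_minus divide_inverse mult_ac)
  qed
  moreover have "u powr (1 - s) * (Gamma s /\<^sub>R \<bar>u\<bar>) = Gamma s * u powr (- s)"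
    using assms by (simp add: powr_diff powr_minus divide_inverse)
  ultimately show ?thesis by (simp only:)
qed

text \<open>\<open>\<integral>\<^sub>0\<^sup>1 exp (- u x) du = (1 - exp (- x)) / x\<close> turns the integrand into a nonnegative
  function of two variables, so Tonelli's theorem applies.\<close>

lemma has_bochner_integral_exp_quotient:
  fixes b x S :: real
  assumes b: "-1 < b" "b < 0" and x: "x > 0"
    and S: "(\<lambda>k. x ^ k / (fact k * (real k - b))) sums S"
  shows "has_bochner_integral lborel
    (\<lambda>y. indicator {0<..} y * (y powr b * ((1 - exp (- (y - x))) / (y - x)))) (Gamma (b + 1) * S)"
proof (rule has_bochner_integral_nn_integral)
  have G: "Gamma (b + 1) > 0" using b by simp
  \<comment> \<open>Expanding \<open>exp (u * x)\<close> and integrating u^(k-b-1) over [0,1] gives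
    1 / (k - b); at k = 0 this uses b < 0.\<close>
  have "has_bochner_integral lborel (\<lambda>u. indicator {0..1} u * (Gamma (b + 1) * (u powr (- (b + 1)) * exp (u * x)))) (Gamma (b + 1) * S)"
  proof (rule has_bochner_integral_sums_nonneg)
    show "has_bochner_integral lborel (\<lambda>u. Gamma (b + 1) * x ^ k / fact k * (indicator {0..1} u * u powr (real k - (b + 1))))
       (Gamma (b + 1) * x ^ k / fact k * (1 powr (real k - (b + 1) + 1) / (real k - (b + 1) + 1)))" for k
      by (intro has_bochner_integral_mult_right has_bochner_integral_powr_from_0) (use b in auto)
    show "0 \<le> Gamma (b + 1) * x ^ k / fact k * (indicator {0..1} u * u powr (real k - (b + 1)))" for k u
      using G x by simp
    show "AE u in lborel. (\<lambda>k. Gamma (b + 1) * x ^ k / fact k * (indicator {0..1} u * u powr (real k - (b + 1)))) sums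
        (indicator {0..1} u * (Gamma (b + 1) * (u powr (- (b + 1)) * exp (u * x))))"
      using AE_lborel_singleton[of 0]
    proof eventually_elim
      case (elim u)
      have "(\<lambda>k. (Gamma (b + 1) * indicator {0..1} u * u powr (- (b + 1))) * ((u * x) ^ k /\<^sub>R fact k)) sums
         ((Gamma (b + 1) * indicator {0..1} u * u powr (- (b + 1))) * exp (u * x))"
        by (intro sums_mult exp_converges)
      moreover have "(Gamma (b + 1) * indicator {0..1} u * u powr (- (b + 1))) * ((u * x) ^ k /\<^sub>R fact k)
         = Gamma (b + 1) * x ^ k / fact k * (indicator {0..1} u * u powr (real k - (b + 1)))" for k
      proof (cases "u \<in> {0..1}")
        case True
        with elim have "u powr (real k - (b + 1)) = u powr (- (b + 1)) * u ^ k"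
          by (simp add: powr_realpow[symmetric] powr_add[symmetric] algebra_simps)
        then show ?thesis by (simp add: power_mult_distrib divide_inverse mult_ac)
      qed simp
      ultimately show ?case by (simp add: mult_ac)
    qed
    show "(\<lambda>k. Gamma (b + 1) * x ^ k / fact k * (1 powr (real k - (b + 1) + 1) / (real k - (b + 1) + 1))) sums (Gamma (b + 1) * S)"
      using sums_mult[OF S, of "Gamma (b + 1)"] by simp
  qed measurable
  then have *: "(\<integral>\<^sup>+u. ennreal (indicator {0..1} u * (Gamma (b + 1) * (u powr (- (b + 1)) * exp (u * x)))) \<partial>lborel) = ennreal (Gamma (b + 1) * S)"
    using G by (subst nn_integral_eq_integral) (auto simp: has_bochner_integral_iff)
  have "0 \<le> S"
    using b x by (intro sums_le[OF _ sums_zero S]) auto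
  then show "0 \<le> Gamma (b + 1) * S" using G by simp
  \<comment> \<open>Numerator and denominator have the same sign.\<close>
  have exp_le: "0 \<le> (1 - exp (- z)) / z" for z :: real
    by (cases "z \<ge> 0") (auto simp: divide_nonpos_neg)
  show "AE y in lborel. 0 \<le> indicator {0<..} y * (y powr b * ((1 - exp (- (y - x))) / (y - x)))"
    by (intro AE_I2 mult_nonneg_nonneg exp_le) auto
  have inner: "(\<integral>\<^sup>+u. ennreal (indicator {0..1} u * exp (- u * z)) \<partial>lborel) = ennreal ((1 - exp (- z)) / z)"
    if "z \<noteq> 0" for z :: real
  proof -
    have "(\<integral>\<^sup>+u. ennreal (exp (- u * z)) * indicator {0..1} u \<partial>lborel) = ennreal ((- exp (- 1 * z) / z) - (- exp (- 0 * z) / z))"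
      by (rule nn_integral_FTC_Icc) (use that in \<open>auto intro!: derivative_eq_intros\<close>)
    then show ?thesis by (simp add: diff_divide_distrib mult_ac ennreal_mult'' ennreal_indicator)
  qed
  have "(\<integral>\<^sup>+y. ennreal (indicator {0<..} y * (y powr b * ((1 - exp (- (y - x))) / (y - x)))) \<partial>lborel)
    = (\<integral>\<^sup>+y. (\<integral>\<^sup>+u. ennreal (indicator {0..} y * y powr b) * ennreal (indicator {0..1} u * exp (- u * (y - x))) \<partial>lborel) \<partial>lborel)"
  proof (rule nn_integral_cong_AE)
    \<comment> \<open>At y = x the quotient is 0 by division by zero while the inner integral is 1,
      so this point is discarded.\<close>
    show "AE y in lborel. ennreal (indicator {0<..} y * (y powr b * ((1 - exp (- (y - x))) / (y - x)))) =
        (\<integral>\<^sup>+u. ennreal (indicator {0..} y * y powr b) * ennreal (indicator {0..1} u * exp (- u * (y - x))) \<partial>lborel)"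
      using AE_lborel_singleton[of x] AE_lborel_singleton[of 0]
    proof eventually_elim
      case (elim y)
      have "(\<integral>\<^sup>+u. ennreal (indicator {0..} y * y powr b) * ennreal (indicator {0..1} u * exp (- u * (y - x))) \<partial>lborel)
         = ennreal (indicator {0..} y * y powr b) * ennreal ((1 - exp (- (y - x))) / (y - x))"
        by (subst nn_integral_cmult) (use inner[of "y - x"] elim in auto)
      also have "\<dots> = ennreal (indicator {0..} y * y powr b * ((1 - exp (- (y - x))) / (y - x)))"
        by (rule ennreal_mult''[symmetric]) (rule exp_le)
      also have "indicator {0..} y * y powr b * ((1 - exp (- (y - x))) / (y - x))
          = indicator {0<..} y * (y powr b * ((1 - exp (- (y - x))) / (y - x)))"
        using elim by (auto simp: indicator_def)
      finally show ?case by simp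
    qed
  qed
  also have "\<dots> = (\<integral>\<^sup>+u. (\<integral>\<^sup>+y. ennreal (indicator {0..} y * y powr b) * ennreal (indicator {0..1} u * exp (- u * (y - x))) \<partial>lborel) \<partial>lborel)"
    by (rule lborel_pair.Fubini') measurable
  also have "\<dots> = (\<integral>\<^sup>+u. ennreal (indicator {0..1} u * (Gamma (b + 1) * (u powr (- (b + 1)) * exp (u * x)))) \<partial>lborel)"
  proof (rule nn_integral_cong_AE)
    \<comment> \<open>For u > 0 the inner integral is a scaled Gamma integral. At u = 0 it diverges,
      so that point is discarded.\<close>
    show "AE u in lborel. (\<integral>\<^sup>+y. ennreal (indicator {0..} y * y powr b) * ennreal (indicator {0..1} u * exp (- u * (y - x))) \<partial>lborel)
      = ennreal (indicator {0..1} u * (Gamma (b + 1) * (u powr (- (b + 1)) * exp (u * x))))"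
      using AE_lborel_singleton[of 0]
    proof eventually_elim
      case (elim u)
      show ?case
      proof (cases "u \<in> {0..1}")
        case True
        with elim have u: "u > 0" "u \<le> 1" by auto
        have "has_bochner_integral lborel (\<lambda>y. exp (u * x) * (indicator {0..} y * (y powr b * exp (- u * y)))) (exp (u * x) * (Gamma (b + 1) * u powr (- (b + 1))))"
          using has_bochner_integral_mult_right[OF has_bochner_integral_Gamma_scaled[of "b + 1" u], of "exp (u * x)"] b u by simp
        then have "(\<integral>\<^sup>+y. ennreal (exp (u * x) * (indicator {0..} y * (y powr b * exp (- u * y)))) \<partial>lborel) = ennreal (exp (u * x) * (Gamma (b + 1) * u powr (- (b + 1))))"
          by (subst nn_integral_eq_integral) (auto simp: has_bochner_integral_iff)
        moreover have "ennreal (indicator {0..} y * y powr b) * ennreal (indicator {0..1} u * exp (- u * (y - x)))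
            = ennreal (exp (u * x) * (indicator {0..} y * (y powr b * exp (- u * y))))" for y
          using u by (subst ennreal_mult'[symmetric]) (simp_all add: algebra_simps exp_diff exp_minus divide_inverse)
        ultimately show ?thesis using u by (simp add: mult_ac)
      qed simp
    qed
  qed
  also note *
  finally show "(\<integral>\<^sup>+y. ennreal (indicator {0<..} y * (y powr b * ((1 - exp (- (y - x))) / (y - x)))) \<partial>lborel) = ennreal (Gamma (b + 1) * S)" .
qed measurable

text \<open>Integrate 1 / (x - y) = sum of y^k / x^(k+1) termwise against y^b - x^b. Subtracting x^b
  removes the singularity at x, and b < 0 makes every term nonnegative on (0, x].\<close>

lemma has_bochner_integral_powr_quotient_left:
  fixes b x :: real
  assumes b: "-1 < b" "b < 0" and x: "x > 0"
    and A: "(\<lambda>k. 1 / (real k + (b + 1)) - 1 / (real k + 1)) sums A"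
  shows "has_bochner_integral lborel (\<lambda>y. indicator {0<..x} y * ((y powr b - x powr b) / (x - y))) (x powr b * A)"
proof (rule has_bochner_integral_sums_nonneg)
  let ?f = "\<lambda>k y. x powr (- real k - 1) * (indicator {0..x} y * y powr (real k + b) - x powr b * (indicator {0..x} y * y powr real k))"
  show "has_bochner_integral lborel (?f k) (x powr (- real k - 1) * (x powr (real k + b + 1) / (real k + b + 1) - x powr b * (x powr (real k + 1) / (real k + 1))))" for k
    by (intro has_bochner_integral_mult_right has_bochner_integral_diff has_bochner_integral_powr_from_0) (use b x in auto)
  have "x powr (- real k - 1) * (x powr (real k + b + 1) / (real k + b + 1) - x powr b * (x powr (real k + 1) / (real k + 1)))
     = x powr b * (1 / (real k + (b + 1)) - 1 / (real k + 1))" for k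
  proof -
    have "x powr (- real k - 1) * x powr (real k + b + 1) = x powr b"
      "x powr (- real k - 1) * (x powr b * x powr (real k + 1)) = x powr b"
      by (simp_all flip: powr_add)
    then show ?thesis by (simp add: right_diff_distrib add.assoc)
  qed
  then show "(\<lambda>k. x powr (- real k - 1) * (x powr (real k + b + 1) / (real k + b + 1) - x powr b * (x powr (real k + 1) / (real k + 1)))) sums (x powr b * A)"
    using sums_mult[OF A, of "x powr b"] by simp
  \<comment> \<open>At y = 0 all terms vanish, including k = 0, because
    \<open>0 powr 0 = 0\<close>.\<close>
  show "0 \<le> ?f k y" for k y
  proof (cases "y \<in> {0<..x}")
    case True
    then have "x powr b \<le> y powr b" using b by (intro powr_mono2') auto
    with True show ?thesis by (simp add: powr_add mult.commute mult_left_mono)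
  qed (auto simp: indicator_def)
  show "AE y in lborel. (\<lambda>k. ?f k y) sums (indicator {0<..x} y * ((y powr b - x powr b) / (x - y)))"
    using AE_lborel_singleton[of x]
  proof eventually_elim
    case (elim y)
    show ?case
    proof (cases "y \<in> {0<..x}")
      case True
      with elim x have y: "0 < y" "y < x" by auto
      have "(\<lambda>k. (y powr b - x powr b) / x * (y / x) ^ k) sums ((y powr b - x powr b) / x * (1 / (1 - y / x)))"
        using y by (intro sums_mult geometric_sums) auto
      moreover have "(y powr b - x powr b) / x * (y / x) ^ k = ?f k y" for k
        using y x by (simp add: powr_add powr_diff powr_minus powr_realpow power_divide power_inverse divide_inverse algebra_simps)
      moreover have "(y powr b - x powr b) / x * (1 / (1 - y / x)) = (y powr b - x powr b) / (x - y)"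
        using y x by (simp add: field_simps)
      ultimately have "(\<lambda>k. ?f k y) sums ((y powr b - x powr b) / (x - y))" by (simp only:)
      then show ?thesis using y by simp
    qed (auto simp: indicator_def)
  qed
qed measurable

text \<open>Here 1 / (y - x) = sum of x^k / y^(k+1). Subtracting x^(b+1) / y instead of x^b fits the
  tail of the kernel in \<open>has_pv_integral_kernel\<close>; nonnegativity of the terms now comes
  from b + 1 > 0.\<close>

lemma has_bochner_integral_powr_quotient_right:
  fixes b x :: real
  assumes b: "-1 < b" "b < 0" and x: "x > 0"
    and A: "(\<lambda>k. 1 / (real k + (- b)) - 1 / (real k + 1)) sums A"
  shows "has_bochner_integral lborel (\<lambda>y. indicator {x<..} y * ((y powr b - x powr (b + 1) / y) / (y - x))) (x powr b * A)"
proof (rule has_bochner_integral_sums_nonneg)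
  let ?f = "\<lambda>k y. x powr real k * (indicator {x..} y * y powr (b - 1 - real k) - x powr (b + 1) * (indicator {x..} y * y powr (- 2 - real k)))"
  show "has_bochner_integral lborel (?f k) (x powr real k * (- (x powr (b - 1 - real k + 1)) / (b - 1 - real k + 1) - x powr (b + 1) * (- (x powr (- 2 - real k + 1)) / (- 2 - real k + 1))))" for k
    by (intro has_bochner_integral_mult_right has_bochner_integral_diff has_bochner_integral_powr_to_inf) (use b x in auto)
  have "x powr real k * (- (x powr (b - 1 - real k + 1)) / (b - 1 - real k + 1) - x powr (b + 1) * (- (x powr (- 2 - real k + 1)) / (- 2 - real k + 1)))
     = x powr b * (1 / (real k + (- b)) - 1 / (real k + 1))" for k
  proof -
    have e: "b - 1 - real k + 1 = - (real k + (- b))" "- 2 - real k + 1 = - (real k + 1)" by simp_all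
    have "x powr real k * x powr (- (real k + (- b))) = x powr b"
      "x powr real k * (x powr (b + 1) * x powr (- (real k + 1))) = x powr b"
      by (simp_all flip: powr_add)
    then show ?thesis unfolding e by (simp only: minus_divide_divide right_diff_distrib times_divide_eq_right)
  qed
  then show "(\<lambda>k. x powr real k * (- (x powr (b - 1 - real k + 1)) / (b - 1 - real k + 1) - x powr (b + 1) * (- (x powr (- 2 - real k + 1)) / (- 2 - real k + 1)))) sums (x powr b * A)"
    using sums_mult[OF A, of "x powr b"] by (simp only:)
  have f: "?f k y = (y powr b - x powr (b + 1) / y) / y * (x / y) ^ k" if "y > x" for k y
    using that x by (simp add: powr_add powr_diff powr_minus powr_realpow power_divide power_inverse divide_inverse algebra_simps power2_eq_square powr_numeral)
  show "0 \<le> ?f k y" for k y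
  proof -
    consider "y > x" | "y = x" | "y < x" by linarith
    then show ?thesis
    proof cases
      case 1
      have "x powr (b + 1) \<le> y powr (b + 1)" using b x 1 by (intro powr_mono2) auto
      then have "x powr (b + 1) / y \<le> y powr b" using 1 x by (simp add: powr_add field_simps)
      then show ?thesis unfolding f[OF 1] using 1 x by simp
    next
      case 2
      have "x powr (b - 1 - real k) = x powr (b + 1) * x powr (- 2 - real k)"
        by (simp add: powr_add[symmetric] algebra_simps)
      with 2 show ?thesis by simp
    qed simp
  qed
  show "AE y in lborel. (\<lambda>k. ?f k y) sums (indicator {x<..} y * ((y powr b - x powr (b + 1) / y) / (y - x)))"
    using AE_lborel_singleton[of x]
  proof eventually_elim
    case (elim y)
    show ?case
    proof (cases "y > x")
      case True
      have "(\<lambda>k. (y powr b - x powr (b + 1) / y) / y * (x / y) ^ k) sums ((y powr b - x powr (b + 1) / y) / y * (1 / (1 - x / y)))"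
        using True x by (intro sums_mult geometric_sums) auto
      moreover have "Q / y * (1 / (1 - x / y)) = Q / (y - x)" for Q
        using True x by (simp add: divide_simps)
      ultimately have "(\<lambda>k. ?f k y) sums ((y powr b - x powr (b + 1) / y) / (y - x))"
        by (simp only: f[OF True])
      then show ?thesis using True by simp
    qed (use elim in auto)
  qed
qed measurable

subsection \<open>Principal values\<close>

text \<open>Every removed ball contains its centre, so the value at the singularity never
  enters.\<close>

lemma has_pv_integral_cong:
  assumes "\<And>y. y \<in> S \<Longrightarrow> y \<noteq> x \<Longrightarrow> f y = g y"
  shows "has_pv_integral f I S x \<longleftrightarrow> has_pv_integral g I S x"
proof -
  have *: "indicator (S - ball x \<epsilon>) y *\<^sub>R f y = indicator (S - ball x \<epsilon>) y *\<^sub>R g y" if "\<epsilon> > 0" for \<epsilon> y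
    using assms[of y] that by (cases "y = x") (auto simp: indicator_def)
  have "((\<lambda>\<epsilon>. set_lebesgue_integral lborel (S - ball x \<epsilon>) f) \<longlongrightarrow> I) (at_right 0)
    \<longleftrightarrow> ((\<lambda>\<epsilon>. set_lebesgue_integral lborel (S - ball x \<epsilon>) g) \<longlongrightarrow> I) (at_right 0)"
    by (intro tendsto_cong eventually_mono[OF eventually_at_right_less[of 0]])
       (simp add: set_lebesgue_integral_def * del: real_scaleR_def)
  then show ?thesis
    unfolding has_pv_integral_def set_integrable_def by (simp add: * cong: conj_cong del: real_scaleR_def)
qed

lemma has_pv_integral_add:
  assumes "has_pv_integral f I S x" "has_pv_integral g J S x"
  shows "has_pv_integral (\<lambda>y. f y + g y) (I + J) S x"
proof -
  have "((\<lambda>\<epsilon>. set_lebesgue_integral lborel (S - ball x \<epsilon>) f + set_lebesgue_integral lborel (S - ball x \<epsilon>) g) \<longlongrightarrow> I + J) (at_right 0)"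
    using assms unfolding has_pv_integral_def by (intro tendsto_add) auto
  moreover have "\<forall>\<^sub>F \<epsilon> in at_right 0. set_lebesgue_integral lborel (S - ball x \<epsilon>) f + set_lebesgue_integral lborel (S - ball x \<epsilon>) g
      = set_lebesgue_integral lborel (S - ball x \<epsilon>) (\<lambda>y. f y + g y)"
    using eventually_at_right_less[of 0]
    by eventually_elim (use assms in \<open>simp add: has_pv_integral_def set_integral_add\<close>)
  ultimately show ?thesis
    using assms unfolding has_pv_integral_def
    by (auto intro: set_integral_add elim: Lim_transform_eventually)
qed

lemma has_pv_integral_mult_right:
  assumes "has_pv_integral f I S x"
  shows "has_pv_integral (\<lambda>y. c * f y) (c * I) S x"
  using assms unfolding has_pv_integral_def by (auto intro: tendsto_mult_left)

lemma has_pv_integral_sum: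
  assumes "finite A" "\<And>i. i \<in> A \<Longrightarrow> has_pv_integral (f i) (I i) S x"
  shows "has_pv_integral (\<lambda>y. \<Sum>i\<in>A. f i y) (\<Sum>i\<in>A. I i) S x"
  using assms
proof (induction A rule: finite_induct)
  case empty
  then show ?case by (simp add: has_pv_integral_def set_integrable_def set_lebesgue_integral_def)
next
  case (insert i A)
  then show ?case by (simp add: has_pv_integral_add)
qed

text \<open>Dominated convergence along sequences of radii tending to 0: off the point x, the
  cut-off is eventually 1.\<close>

lemma has_bochner_integral_imp_has_pv_integral:
  fixes f :: "real \<Rightarrow> real"
  assumes f: "has_bochner_integral lborel (\<lambda>y. indicator S y * f y) I"
    and [measurable]: "S \<in> sets borel"
  shows "has_pv_integral f I S x"
proof -
  have int: "set_integrable lborel S f" and I: "I = (\<integral>y. indicator S y * f y \<partial>lborel)"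
    using f by (auto simp: has_bochner_integral_iff set_integrable_def)
  have [measurable]: "(\<lambda>y. indicator S y * f y) \<in> borel_measurable lborel"
    using f by (rule borel_measurable_has_bochner_integral)
  have eq: "indicator (S - ball x \<epsilon>) y *\<^sub>R f y = indicator (- ball x \<epsilon>) y * (indicator S y * f y)" for \<epsilon> y
    by (auto simp: indicator_def)
  have "((\<lambda>\<epsilon>. set_lebesgue_integral lborel (S - ball x \<epsilon>) f) \<longlongrightarrow> I) (at_right 0)"
    unfolding tendsto_at_iff_sequentially
  proof (intro allI impI)
    fix X :: "nat \<Rightarrow> real"
    assume X: "\<forall>i. X i \<in> {0<..} - {0}" "X \<longlonglongrightarrow> 0"
    have "(\<lambda>i. \<integral>y. indicator (- ball x (X i)) y * (indicator S y * f y) \<partial>lborel) \<longlonglongrightarrow> (\<integral>y. indicator S y * f y \<partial>lborel)"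
    proof (rule integral_dominated_convergence)
      show "integrable lborel (\<lambda>y. \<bar>indicator S y * f y\<bar>)"
        using f by (auto simp: has_bochner_integral_iff intro: integrable_abs)
      show "AE y in lborel. (\<lambda>i. indicator (- ball x (X i)) y * (indicator S y * f y)) \<longlonglongrightarrow> indicator S y * f y"
        using AE_lborel_singleton[of x]
      proof eventually_elim
        case (elim y)
        have "\<forall>\<^sub>F i in sequentially. X i < dist x y"
          using elim by (intro order_tendstoD(2)[OF X(2)]) auto
        then show ?case
          by (intro tendsto_eventually, eventually_elim) (auto simp: indicator_def)
      qed
    qed (measurable, auto simp: indicator_def)
    then show "((\<lambda>\<epsilon>. set_lebesgue_integral lborel (S - ball x \<epsilon>) f) \<circ> X) \<longlonglongrightarrow> I"
      unfolding I comp_def set_lebesgue_integral_def eq .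
  qed
  then show ?thesis
    unfolding has_pv_integral_def by (auto intro: set_integrable_subset[OF int])
qed

text \<open>The tail \<open>x / (y (y - x)) = 1 / (y - x) - 1 / y\<close> makes the kernel integrable at infinity
  while both truncated pieces keep elementary antiderivatives.\<close>

lemma has_pv_integral_kernel:
  fixes x :: real
  assumes x: "x > 0"
  shows "has_pv_integral (\<lambda>y. if y \<le> x then 1 / (y - x) else x / (y * (y - x))) 0 {0<..} x"
proof -
  let ?h = "\<lambda>y::real. if y \<le> x then 1 / (y - x) else x / (y * (y - x))"
  \<comment> \<open>The left piece contributes ln \<epsilon> - ln x. On the right, the
    antiderivative ln(1 - x/y) tends to 0 at infinity and gives ln(x + \<epsilon>) - ln \<epsilon>.
    The divergent logarithms cancel.\<close>
  have int: "has_bochner_integral lborel (\<lambda>y. indicator ({0<..} - ball x \<epsilon>) y *\<^sub>R ?h y) (ln ((x + \<epsilon>) / x))"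
    if \<epsilon>: "0 < \<epsilon>" "\<epsilon> < x" for \<epsilon>
  proof -
    have "((\<lambda>y. 1 / (x - y)) has_integral (- ln (x - (x - \<epsilon>)) - (- ln (x - 0)))) {0..x - \<epsilon>}"
      using \<epsilon> by (intro fundamental_theorem_of_calculus)
        (auto intro!: derivative_eq_intros simp flip: has_real_derivative_iff_has_vector_derivative)
    then have left: "has_bochner_integral lborel (\<lambda>y. indicator {0..x - \<epsilon>} y * (1 / (x - y))) (ln x - ln \<epsilon>)"
      using \<epsilon> by (intro has_bochner_integral_has_integral_nonneg) auto
    have "(\<integral>\<^sup>+y. ennreal (x / (y * (y - x))) * indicator {x + \<epsilon>..} y \<partial>lborel) = ennreal (0 - ln (1 - x / (x + \<epsilon>)))"
    proof (rule nn_integral_FTC_atLeast)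
      show "((\<lambda>y. ln (1 - x / y)) \<longlongrightarrow> 0) at_top"
        by real_asymp
      show "((\<lambda>y. ln (1 - x / y)) has_real_derivative x / (y * (y - x))) (at y)" if "x + \<epsilon> \<le> y" for y
        using that \<epsilon> x by (auto intro!: derivative_eq_intros simp: field_simps power2_eq_square)
    qed (use \<epsilon> x in auto)
    moreover have "1 - x / (x + \<epsilon>) = \<epsilon> / (x + \<epsilon>)"
      using \<epsilon> by (simp add: field_simps)
    moreover have "ennreal (x / (y * (y - x))) * indicator {x + \<epsilon>..} y = ennreal (indicator {x + \<epsilon>..} y * (x / (y * (y - x))))" for y
      by (auto simp: indicator_def)
    ultimately have "(\<integral>\<^sup>+y. ennreal (indicator {x + \<epsilon>..} y * (x / (y * (y - x)))) \<partial>lborel) = ennreal (- ln (\<epsilon> / (x + \<epsilon>)))"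
      by simp
    then have "has_bochner_integral lborel (\<lambda>y. indicator {x + \<epsilon>..} y * (x / (y * (y - x)))) (- ln (\<epsilon> / (x + \<epsilon>)))"
      using \<epsilon> by (intro has_bochner_integral_nn_integral) (auto simp: indicator_def)
    from has_bochner_integral_diff[OF this left]
    have diff: "has_bochner_integral lborel (\<lambda>y. indicator {x + \<epsilon>..} y * (x / (y * (y - x))) - indicator {0..x - \<epsilon>} y * (1 / (x - y)))
       (- ln (\<epsilon> / (x + \<epsilon>)) - (ln x - ln \<epsilon>))" .
    have value_eq: "- ln (\<epsilon> / (x + \<epsilon>)) - (ln x - ln \<epsilon>) = ln ((x + \<epsilon>) / x)"
      using \<epsilon> by (simp add: ln_div)
    have ae: "AE y in lborel. indicator {x + \<epsilon>..} y * (x / (y * (y - x))) - indicator {0..x - \<epsilon>} y * (1 / (x - y))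
        = indicator ({0<..} - ball x \<epsilon>) y *\<^sub>R ?h y"
      using AE_lborel_singleton[of 0]
    proof eventually_elim
      case (elim y)
      have "- (1 / (x - y)) = 1 / (y - x)"
        by (metis minus_diff_eq minus_divide_right)
      then show ?case
        using elim \<epsilon> by (auto simp: indicator_def dist_real_def abs_if split: if_splits)
    qed
    have [measurable]: "{0<..} - ball x \<epsilon> \<in> sets borel"
      by auto
    show ?thesis
      using diff unfolding value_eq
      by (rule has_bochner_integral_cong_AE[THEN iffD1, OF _ _ ae, rotated 2]) measurable
  qed
  have "set_integrable lborel ({0<..} - ball x \<epsilon>) ?h" if "\<epsilon> > 0" for \<epsilon>
  proof -
    \<comment> \<open>The logarithmic formula requires \<epsilon> < x; larger radii leave a smaller
      set.\<close>
    have "set_integrable lborel ({0<..} - ball x (min \<epsilon> (x / 2))) ?h"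
      using int[of "min \<epsilon> (x / 2)"] that x by (simp add: set_integrable_def has_bochner_integral_iff)
    then show ?thesis
      by (rule set_integrable_subset) auto
  qed
  moreover have "((\<lambda>\<epsilon>. set_lebesgue_integral lborel ({0<..} - ball x \<epsilon>) ?h) \<longlongrightarrow> 0) (at_right 0)"
  proof (rule Lim_transform_eventually)
    have "((\<lambda>\<epsilon>. ln ((x + \<epsilon>) / x)) \<longlongrightarrow> ln ((x + 0) / x)) (at_right 0)"
      using x by (intro tendsto_intros) auto
    then show "((\<lambda>\<epsilon>. ln ((x + \<epsilon>) / x)) \<longlongrightarrow> 0) (at_right 0)"
      using x by simp
    have "\<forall>\<^sub>F \<epsilon> in at_right 0. \<epsilon> \<in> {0<..<x}"
      using x by (rule eventually_at_right_real)
    then show "\<forall>\<^sub>F \<epsilon> in at_right 0. ln ((x + \<epsilon>) / x) = set_lebesgue_integral lborel ({0<..} - ball x \<epsilon>) ?h"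
      by eventually_elim (use int in \<open>auto simp: set_lebesgue_integral_def has_bochner_integral_iff\<close>)
  qed
  ultimately show ?thesis unfolding has_pv_integral_def by blast
qed

text \<open>Off y = x, e^x times the integrand is \<open>?R - (?K + ?L) + x powr b * ?h\<close>. The
  first three functions are absolutely integrable with known integrals, and \<open>?h\<close> has
  principal value 0.\<close>

lemma has_pv_integral_powr_exp_neg:
  fixes b x :: real
  assumes b: "-1 < b" "b < 0" and x: "x > 0"
  shows "has_pv_integral (\<lambda>y. y powr b * exp (- y) / (y - x))
    (exp (- x) * (- Gamma (b + 1) * shifted_exp b x - pi * cot (pi * b) * x powr b)) {0<..} x"
proof -
  let ?K = "\<lambda>y. indicator {0<..} y * (y powr b * ((1 - exp (- (y - x))) / (y - x)))"
  let ?L = "\<lambda>y. indicator {0<..x} y * ((y powr b - x powr b) / (x - y))"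
  let ?R = "\<lambda>y. indicator {x<..} y * ((y powr b - x powr (b + 1) / y) / (y - x))"
  let ?h = "\<lambda>y::real. if y \<le> x then 1 / (y - x) else x / (y * (y - x))"
  let ?I = "x powr b * (- Digamma (- b) - euler_mascheroni) - (Gamma (b + 1) * shifted_exp b x + x powr b * (- Digamma (b + 1) - euler_mascheroni))"
  have "- b \<notin> \<int>"
  proof
    assume "- b \<in> \<int>"
    then obtain k :: int where "- b = of_int k" by (elim Ints_cases)
    with b have "0 < k" "k < 1" by linarith+
    then show False by simp
  qed
  \<comment> \<open>Reflection at -b pairs -b with b + 1; the sign changes since cot is odd.\<close>
  from Digamma_reflection_real[OF this]
  have "Digamma (- b) = Digamma (b + 1) + pi * cot (pi * b)"
    by (simp add: add.commute)
  then have I: "?I = - Gamma (b + 1) * shifted_exp b x - pi * cot (pi * b) * x powr b"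
    by (simp add: algebra_simps)
  have eq: "?R y - (?K y + ?L y) = indicator {0<..} y * (?R y - (?K y + ?L y))" for y
    using x by (auto simp: indicator_def)
  have "has_bochner_integral lborel (\<lambda>y. ?R y - (?K y + ?L y)) ?I"
    using b x
    by (intro has_bochner_integral_diff has_bochner_integral_add has_bochner_integral_exp_quotient
      has_bochner_integral_powr_quotient_left has_bochner_integral_powr_quotient_right Digamma_sums shifted_exp_sums) auto
  then have "has_bochner_integral lborel (\<lambda>y. indicator {0<..} y * (?R y - (?K y + ?L y))) ?I"
    unfolding eq[symmetric] .
  then have "has_pv_integral (\<lambda>y. ?R y - (?K y + ?L y)) ?I {0<..} x"
    by (rule has_bochner_integral_imp_has_pv_integral) simp
  from has_pv_integral_mult_right[OF has_pv_integral_add[OF this has_pv_integral_mult_right[OF has_pv_integral_kernel[OF x], of "x powr b"]], of "exp (- x)"]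
  have "has_pv_integral (\<lambda>y. exp (- x) * (?R y - (?K y + ?L y) + x powr b * ?h y)) (exp (- x) * ?I) {0<..} x"
    by simp
  moreover have "exp (- x) * (?R y - (?K y + ?L y) + x powr b * ?h y) = y powr b * exp (- y) / (y - x)"
    if "y \<in> {0<..}" "y \<noteq> x" for y
  proof -
    have e: "exp (- (y - x)) = exp (- y) * exp x" "exp (- x) * exp x = 1"
      by (simp_all flip: exp_add)
    \<comment> \<open>In both cases \<open>p\<close>, \<open>q\<close>, \<open>z\<close>,
      \<open>d\<close> stand for y^b, x^b, e^(x-y) and y - x.\<close>
    have "?R y - (?K y + ?L y) + x powr b * ?h y = y powr b * exp (- (y - x)) / (y - x)"
    proof (cases "y < x")
      case True
      have "0 - (p * ((1 - z) / d) + - ((p - q) / d)) + q * (1 / d) = p * z / d" for p q z d :: real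
        by (simp add: algebra_simps add_divide_distrib diff_divide_distrib)
      moreover have "(y powr b - x powr b) / (x - y) = - ((y powr b - x powr b) / (y - x))"
        by (metis minus_diff_eq minus_divide_right)
      ultimately show ?thesis using True that by simp
    next
      case False
      have "(p - q * x / y) / d - (p * ((1 - z) / d) + 0) + q * (x / (y * d)) = p * z / d" for p q z d :: real
        by (simp add: algebra_simps add_divide_distrib diff_divide_distrib)
      then show ?thesis using False that x by (simp add: powr_add)
    qed
    then show ?thesis unfolding e using e(2) by simp
  qed
  ultimately show ?thesis
    unfolding I by (subst (asm) has_pv_integral_cong) auto
qed

text \<open>Induction from (-1, 0) upwards: y^(c+1) / (y - x) = y^c + x y^c / (y - x), where the
  first summand against e^(-y) is a Gamma integral.\<close>

lemma has_pv_integral_powr_exp: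
  fixes b x :: real
  assumes "-1 < b" "b \<notin> \<int>" and x: "x > 0"
  shows "has_pv_integral (\<lambda>y. y powr b * exp (- y) / (y - x))
    (exp (- x) * (- Gamma (b + 1) * shifted_exp b x - pi * cot (pi * b) * x powr b)) {0<..} x"
proof -
  have "\<exists>m a. b = a + real m \<and> -1 < a \<and> a < 0"
  proof (intro exI conjI)
    \<comment> \<open>With m = floor(b) + 1 the remainder b - m lies in [-1, 0), and -1 is excluded
      since b is not an integer.\<close>
    show "b = (b - real (nat (\<lfloor>b\<rfloor> + 1))) + real (nat (\<lfloor>b\<rfloor> + 1))" by simp
    have "\<lfloor>b\<rfloor> + 1 \<ge> 0" using assms(1) by linarith
    moreover have "of_int \<lfloor>b\<rfloor> \<noteq> b" using assms(2) by (metis Ints_of_int)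
    ultimately show "-1 < b - real (nat (\<lfloor>b\<rfloor> + 1))" "b - real (nat (\<lfloor>b\<rfloor> + 1)) < 0"
      by linarith+
  qed
  then obtain m a where b: "b = a + real m" and a: "-1 < a" "a < 0" by blast
  from assms(1,2) show ?thesis
    unfolding b
  proof (induction m)
    case 0
    with has_pv_integral_powr_exp_neg[OF a x] show ?case by simp
  next
    case (Suc m)
    define c where "c = a + real m"
    have c: "a + real (Suc m) = c + 1" by (simp add: c_def)
    have cZ: "c \<notin> \<int>" using Suc.prems(2) unfolding c by auto
    have c1: "-1 < c" using a by (simp add: c_def)
    have IH: "has_pv_integral (\<lambda>y. y powr c * exp (- y) / (y - x))
      (exp (- x) * (- Gamma (c + 1) * shifted_exp c x - pi * cot (pi * c) * x powr c)) {0<..} x"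
      using Suc.IH c1 cZ by (simp add: c_def)
    have "has_bochner_integral lborel (\<lambda>y. indicator {0<..} y * (y powr c * exp (- y))) (Gamma (c + 1))"
    proof -
      have eq: "indicator {0..} y * (y powr c * exp (- y)) = indicator {0<..} y * (y powr c * exp (- y))" for y :: real
        by (auto simp: indicator_def)
      show ?thesis
        unfolding eq[symmetric] using has_bochner_integral_Gamma_scaled[of "c + 1" 1] c1 by simp
    qed
    then have "has_pv_integral (\<lambda>y. y powr c * exp (- y)) (Gamma (c + 1)) {0<..} x"
      by (rule has_bochner_integral_imp_has_pv_integral) simp
    from has_pv_integral_add[OF this has_pv_integral_mult_right[OF IH, of x]]
    have "has_pv_integral (\<lambda>y. y powr c * exp (- y) + x * (y powr c * exp (- y) / (y - x)))
      (Gamma (c + 1) + x * (exp (- x) * (- Gamma (c + 1) * shifted_exp c x - pi * cot (pi * c) * x powr c))) {0<..} x" .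
    moreover have "y powr c * exp (- y) + x * (y powr c * exp (- y) / (y - x)) = y powr (c + 1) * exp (- y) / (y - x)"
      if "y \<in> {0<..}" "y \<noteq> x" for y
      using that by (simp add: powr_add divide_simps) (simp add: algebra_simps)
    moreover have "Gamma (c + 1) + x * (exp (- x) * (- Gamma (c + 1) * shifted_exp c x - pi * cot (pi * c) * x powr c))
      = exp (- x) * (- Gamma (c + 1 + 1) * shifted_exp (c + 1) x - pi * cot (pi * (c + 1)) * x powr (c + 1))"
    proof -
      have "Gamma (c + 1 + 1) * shifted_exp (c + 1) x = Gamma (c + 1) * ((c + 1) * shifted_exp (c + 1) x)"
        using c1 by (subst Gamma_plus1) (auto elim!: nonpos_Ints_cases)
      also have "\<dots> = Gamma (c + 1) * (x * shifted_exp c x - exp x)"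
        by (simp only: shifted_exp_add_1[OF cZ])
      finally have 1: "Gamma (c + 1 + 1) * shifted_exp (c + 1) x = Gamma (c + 1) * (x * shifted_exp c x - exp x)" .
      have 2: "cot (pi * (c + 1)) = cot (pi * c)"
        by (simp add: cot_def distrib_left)
      have 3: "x powr (c + 1) = x powr c * x" using x by (simp add: powr_add)
      \<comment> \<open>The new Gamma integral is exactly the contribution of \<open>- exp x\<close>
        in \<open>shifted_exp_add_1\<close>.\<close>
      have "exp (- x) * (Gamma (c + 1) * exp x) = Gamma (c + 1)"
        by (simp add: exp_minus)
      then show ?thesis
        unfolding 2 3 mult_minus_left 1 by (simp add: algebra_simps)
    qed
    ultimately show ?case
      unfolding c by (subst (asm) has_pv_integral_cong) auto
  qed
qed

section \<open>Assembly of the Laguerre combination\<close>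

theorem theorem4p1:
  fixes \<alpha> \<xi> :: real and n :: nat
  assumes "\<alpha> > -1" and "\<alpha> \<notin> \<nat>" and "0 < \<xi>"
  shows "pv_integrable (\<lambda>\<eta>. \<eta> powr \<alpha> * exp (-\<eta>) * laguerre n \<alpha> \<eta> / (\<eta> - \<xi>)) {0<..} \<xi> \<and>
    pi * cot (pi * \<alpha>) * (\<xi> powr \<alpha> * exp (-\<xi>) * laguerre n \<alpha> \<xi>)
      + pv_integral (\<lambda>\<eta>. \<eta> powr \<alpha> * exp (-\<eta>) * laguerre n \<alpha> \<eta> / (\<eta> - \<xi>)) {0<..} \<xi>
      = Gamma \<alpha> * exp (-\<xi>) * confluent_hypergeometric (- real n - \<alpha>) (1 - \<alpha>) \<xi>"
proof -
  let ?f = "\<lambda>\<eta>. \<eta> powr \<alpha> * exp (-\<eta>) * laguerre n \<alpha> \<eta> / (\<eta> - \<xi>)"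
  define c where "c k = ((real n + \<alpha>) gchoose (n - k)) * ((-1) ^ k / fact k)" for k
  have laguerre: "laguerre n \<alpha> x = (\<Sum>k\<le>n. c k * x ^ k)" for x
    by (simp add: laguerre_def c_def mult_ac)
  have \<alpha>: "\<alpha> \<notin> \<int>" using assms(1,2) by (rule not_Nats_imp_not_Ints)
  let ?I = "\<lambda>k. exp (- \<xi>) * (- Gamma (\<alpha> + real k + 1) * shifted_exp (\<alpha> + real k) \<xi> - pi * cot (pi * (\<alpha> + real k)) * \<xi> powr (\<alpha> + real k))"
  have "has_pv_integral (\<lambda>\<eta>. \<Sum>k\<le>n. c k * (\<eta> powr (\<alpha> + real k) * exp (- \<eta>) / (\<eta> - \<xi>))) (\<Sum>k\<le>n. c k * ?I k) {0<..} \<xi>"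
    using assms \<alpha> by (intro has_pv_integral_sum has_pv_integral_mult_right has_pv_integral_powr_exp) auto
  moreover have "(\<Sum>k\<le>n. c k * (\<eta> powr (\<alpha> + real k) * exp (- \<eta>) / (\<eta> - \<xi>))) = ?f \<eta>" if "\<eta> \<in> {0<..}" for \<eta>
    using that unfolding laguerre sum_distrib_left sum_divide_distrib
    by (intro sum.cong refl) (simp add: powr_add powr_realpow mult_ac)
  ultimately have pv: "has_pv_integral ?f (\<Sum>k\<le>n. c k * ?I k) {0<..} \<xi>"
    by (subst (asm) has_pv_integral_cong) auto
  \<comment> \<open>By periodicity the cotangent is a common factor, so the terms with \<xi>^k
    recombine to the Laguerre polynomial at \<xi>.\<close>
  have "cot (pi * (\<alpha> + real k)) = cot (pi * \<alpha>)" for k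
    by (simp add: cot_def distrib_left sin_add cos_add mult.commute[of pi "real k"])
  moreover have "\<xi> powr (\<alpha> + real k) = \<xi> powr \<alpha> * \<xi> ^ k" for k
    using assms(3) by (simp add: powr_add powr_realpow)
  ultimately have "(\<Sum>k\<le>n. c k * ?I k) = (\<Sum>k\<le>n. exp (- \<xi>) * (c k * (- Gamma (\<alpha> + real k + 1) * shifted_exp (\<alpha> + real k) \<xi>))
      - pi * cot (pi * \<alpha>) * (\<xi> powr \<alpha> * exp (- \<xi>) * (c k * \<xi> ^ k)))"
    by (simp only:) (intro sum.cong refl, simp add: algebra_simps)
  also have "\<dots> = exp (- \<xi>) * (Gamma \<alpha> * confluent_hypergeometric (- real n - \<alpha>) (1 - \<alpha>) \<xi>)
      - pi * cot (pi * \<alpha>) * (\<xi> powr \<alpha> * exp (- \<xi>) * laguerre n \<alpha> \<xi>)"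
    unfolding sum_subtractf laguerre sum_distrib_left[symmetric]
    unfolding c_def laguerre_shifted_exp[OF assms(1) \<alpha>] ..
  finally show ?thesis
    using pv pv_integral_unique[OF pv] unfolding pv_integrable_def by (auto simp: mult_ac)
qed

end
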